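(* Let $(Q(t))_{t\ge0}$ be a stochastically continuous HA-semigroup on $D$. Suppose that $\int_D|\xi|\,Q(t,x,d\xi)<\infty$ for all $t\ge0$ and $x\in D$, and that for every fixed $x\in D$ the map $t\mapsto |\xi|\,Q(t,x,d\xi)$ from $[0,\infty)$ to the finite measures on $D$ is continuous in the sense of weak convergence of finite measures. Then $(Q(t))_{t\ge0}$ is regular.
   Context: $D=\mathbb{R}_+\times\mathbb{R}$ with $\mathbb{R}_+=[0,\infty)$; $U=\mathbb{C}_-\times(i\mathbb{R})$, where $\mathbb{C}_-=\{a+ib: a\le 0,\ b\in\mathbb{R}\}$ and $i\mathbb{R}=\{ib:b\in\mathbb{R}\}$; $\langle u,\xi\rangle=u_1\xi_1+u_2\xi_2$ (bilinear). HA-semigroup: a transition semigroup $(Q(t))_{t\ge0}$ with state space $D$ such that for each $t\ge0$ there is a continuous two-dimensional complex-valued function $\psi(t,\cdot)=(\psi_1(t,\cdot),\psi_2(t,\cdot))$ on $U$ with $\int_D \exp\{\langle u,\xi\rangle\}Q(t,x,d\xi)=\exp\{\langle x,\psi(t,u)\rangle\}$ for all $x\in D$, $u\in U$. It is stochastically continuous if $t\mapsto Q(t,x,\cdot)$ is weakly continuous on $[0,\infty)$ for each $x\in D$. It is regular if it is stochastically continuous and the derivative $\psi'_t(0,u)$ (of $t\mapsto\psi(t,u)$ at $t=0$) exists for all $u\in U$ and is continuous at $u=0$. *)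

theory Defs
  imports "HOL-Probability.Probability"
begin

definition state_D :: "(real \<times> real) set" where
  "state_D = {0..} \<times> UNIV"

abbreviation borel_D :: "(real \<times> real) measure" where
  "borel_D \<equiv> restrict_space borel state_D"

definition dom_U :: "(complex \<times> complex) set" where
  "dom_U = {z. Re z \<le> 0} \<times> {z. Re z = 0}"

text \<open>The bilinear (not sesquilinear) pairing of complex with real vectors; being symmetric, it
  serves for both exponents in the affine property below.\<close>

definition pairing :: "complex \<times> complex \<Rightarrow> real \<times> real \<Rightarrow> complex" where
  "pairing u \<xi> = fst u * of_real (fst \<xi>) + snd u * of_real (snd \<xi>)"

text \<open>Time is \<open>[0, \<infinity>)\<close>; values of \<open>Q\<close> at negative times or outside the state space are
  irrelevant. Kernels are Markov (total mass one), and \<open>Q 0\<close> is the identity kernel.\<close>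

definition transition_semigroup :: "'a measure \<Rightarrow> (real \<Rightarrow> 'a \<Rightarrow> 'a measure) \<Rightarrow> bool" where
  "transition_semigroup M Q \<longleftrightarrow>
     (\<forall>t\<ge>0. Q t \<in> measurable M (prob_algebra M)) \<and>
     (\<forall>x\<in>space M. Q 0 x = return M x) \<and>
     (\<forall>s\<ge>0. \<forall>t\<ge>0. \<forall>x\<in>space M. Q (s + t) x = bind (Q s x) (Q t))"

definition affine_exponent ::
    "(real \<Rightarrow> real \<times> real \<Rightarrow> (real \<times> real) measure) \<Rightarrow>
     (real \<Rightarrow> complex \<times> complex \<Rightarrow> complex \<times> complex) \<Rightarrow> bool" where
  "affine_exponent Q \<psi> \<longleftrightarrow>
     (\<forall>t\<ge>0. continuous_on dom_U (\<psi> t) \<and>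
        (\<forall>x\<in>state_D. \<forall>u\<in>dom_U.
           (\<integral>\<xi>. exp (pairing u \<xi>) \<partial>Q t x) = exp (pairing (\<psi> t u) x)))"

definition HA_semigroup :: "(real \<Rightarrow> real \<times> real \<Rightarrow> (real \<times> real) measure) \<Rightarrow> bool" where
  "HA_semigroup Q \<longleftrightarrow> transition_semigroup borel_D Q \<and> (\<exists>\<psi>. affine_exponent Q \<psi>)"

text \<open>Weak continuity on \<open>[0, \<infinity>)\<close> of a family of finite measures on a set \<open>S\<close>. The library's
  \<open>weak_conv_m\<close> covers only sequences of measures on the real line.\<close>

definition weakly_continuous :: "'a::topological_space set \<Rightarrow> (real \<Rightarrow> 'a measure) \<Rightarrow> bool" where
  "weakly_continuous S \<mu> \<longleftrightarrow>
     (\<forall>f :: 'a \<Rightarrow> real. continuous_on S f \<longrightarrow> bounded (f ` S) \<longrightarrow>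
        continuous_on {0..} (\<lambda>t. \<integral>\<xi>. f \<xi> \<partial>\<mu> t))"

definition stochastically_continuous ::
    "(real \<Rightarrow> real \<times> real \<Rightarrow> (real \<times> real) measure) \<Rightarrow> bool" where
  "stochastically_continuous Q \<longleftrightarrow> (\<forall>x\<in>state_D. weakly_continuous state_D (\<lambda>t. Q t x))"

lemma affine_exponent_unique:
  assumes "affine_exponent Q \<psi>" "affine_exponent Q \<phi>" "t \<ge> 0" "u \<in> dom_U"
  shows "\<psi> t u = \<phi> t u"
proof -
  have eq: "exp (pairing (\<psi> t u) x) = exp (pairing (\<phi> t u) x)" if "x \<in> state_D" for x
    using assms that unfolding affine_exponent_def by metis
  have *: "a = b" if "\<And>r. r \<ge> 0 \<Longrightarrow> exp (a * of_real r) = exp (b * of_real r)" for a b :: complex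
  proof -
    have D: "((\<lambda>r. exp (c * of_real r)) has_vector_derivative c) (at 0 within {0..})" for c :: complex
    proof -
      have "((\<lambda>z. exp (c * z)) has_field_derivative c) (at (of_real 0))"
        by (auto intro!: derivative_eq_intros)
      from has_vector_derivative_real_field[OF this] show ?thesis
        by (simp add: o_def has_vector_derivative_at_within)
    qed
    have "((\<lambda>r. exp (b * of_real r)) has_vector_derivative a) (at 0 within {0..})"
      by (rule has_vector_derivative_transform[OF _ _ D]) (use that in auto)
    then show ?thesis
      using D[of b] vector_derivative_unique_within
        [of 0 "{0..}" "\<lambda>r. exp (b * of_real r)" a b]
      by (simp add: trivial_limit_within islimpt_in_closure at_within_Ici_at_right)
  qed
  have "fst (\<psi> t u) = fst (\<phi> t u)"
    by (rule *) (use eq[of "(_, 0)"] in \<open>simp add: pairing_def state_D_def\<close>)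
  moreover have "snd (\<psi> t u) = snd (\<phi> t u)"
    by (rule *) (use eq[of "(0, _)"] in \<open>simp add: pairing_def state_D_def\<close>)
  ultimately show ?thesis by (simp add: prod_eq_iff)
qed

text \<open>By the lemma above, the existential over \<open>\<psi>\<close> refers to the unique exponent of \<open>Q\<close>. The time
  derivative at \<open>0\<close> is one-sided, and continuity at \<open>u = 0\<close> is relative to \<open>dom_U\<close>.\<close>

definition regular_HA_semigroup :: "(real \<Rightarrow> real \<times> real \<Rightarrow> (real \<times> real) measure) \<Rightarrow> bool" where
  "regular_HA_semigroup Q \<longleftrightarrow>
     HA_semigroup Q \<and> stochastically_continuous Q \<and>
     (\<exists>\<psi> \<psi>'. affine_exponent Q \<psi> \<and>
        (\<forall>u\<in>dom_U. ((\<lambda>t. \<psi> t u) has_vector_derivative \<psi>' u) (at 0 within {0..})) \<and>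
        continuous (at 0 within dom_U) \<psi>')"

end

theory Submission
  imports Defs
begin

text \<open>
  Write \<open>f\<^sub>x(r, u)\<close> for the integral of \<open>exp \<langle>u, \<xi>\<rangle>\<close> against \<open>Q(r, x, d\<xi>)\<close>. The semigroup property gives
  \<open>f\<^sub>x(r + t, u) = f\<^sub>x(r, \<psi>(t, u))\<close>. Integrating \<open>f\<^sub>x(r + t, u) - f\<^sub>x(r, u)\<close> over \<open>r \<in> [0, s]\<close>
  and dividing by \<open>t\<close>, the left-hand side converges to \<open>f\<^sub>x(s, u) - f\<^sub>x(0, u)\<close> as \<open>t \<rightarrow> 0\<close> by the
  fundamental theorem of calculus, while the right-hand side is \<open>(\<psi>(t, u) - u) / t\<close> multiplied by
  integrated divided differences of \<open>f\<^sub>x\<close> in \<open>u\<close>. The first-moment hypotheses make these converge, by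
  dominated convergence, to the time integral of the gradient of \<open>f\<^sub>x\<close>. For \<open>x = (1, 0)\<close> and
  \<open>x = (0, 1)\<close> this is a \<open>2 \<times> 2\<close> linear system for the difference quotient whose determinant
  behaves like \<open>s\<^sup>2 exp (u\<^sub>1 + u\<^sub>2)\<close> for small \<open>s\<close>, so it can be solved. The resulting formula for the
  derivative holds with the same \<open>s\<close> for all \<open>u\<close> near \<open>0\<close>, which yields continuity there.
\<close>

section \<open>Convergence of exponents from convergence of exponentials\<close>

text \<open>The exponentials at \<open>x = 1\<close> alone determine \<open>w\<close> only modulo \<open>2\<pi>\<i>\<close>; integrating
  over \<open>x\<close> gives \<open>w = (exp w - 1) / (\<integral>\<^sub>0\<^sup>1 exp (x w) dx)\<close>, where the denominator tends to 1.\<close>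

lemma exp_mult_tendsto_1_imp_tendsto_0:
  fixes w :: "nat \<Rightarrow> complex"
  assumes lim: "\<And>x. 0 \<le> x \<Longrightarrow> x \<le> 1 \<Longrightarrow> (\<lambda>n. exp (of_real x * w n)) \<longlonglongrightarrow> 1"
  shows "w \<longlonglongrightarrow> 0"
proof -
  define I where "I n = integral {0..1} (\<lambda>x::real. exp (of_real x * w n))" for n
  have int: "(\<lambda>x::real. exp (of_real x * w n)) integrable_on {0..1}" for n
    by (intro integrable_continuous_real continuous_intros)
  have w1: "(\<lambda>n. exp (w n)) \<longlonglongrightarrow> 1"
    using lim[of 1] by simp
  then obtain K where K: "norm (exp (w n)) \<le> K" for n
    using convergent_imp_bounded bounded_iff by (metis rangeI)
  \<comment> \<open>For \<open>x\<close> between 0 and 1 the modulus is at most the larger of 1 and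
    \<open>norm (exp (w n))\<close>, and the latter is bounded by \<open>K\<close> because
    \<open>exp (w n)\<close> converges. This constant majorant permits dominated convergence in
    \<open>x\<close>.\<close>
  have "norm (exp (of_real x * w n)) \<le> 1 + K" if "x \<in> {0..1}" for n and x :: real
  proof -
    have "x * Re (w n) \<le> max 0 (Re (w n))"
      using that by (auto simp: max_def mult_left_le_one_le mult_nonneg_nonpos)
    then have "exp (x * Re (w n)) \<le> max 1 (exp (Re (w n)))"
      by (smt (verit) exp_le_cancel_iff exp_zero max_def)
    also have "\<dots> \<le> 1 + K"
      using K[of n] by (auto intro: order_trans[OF exp_ge_zero])
    finally show ?thesis by simp
  qed
  then have "I \<longlonglongrightarrow> integral {0..1} (\<lambda>x::real. 1 :: complex)"
    unfolding I_def by (intro dominated_convergence(2)[OF int, where h = "\<lambda>_. 1 + K"]) (auto intro!: lim)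
  then have I1: "I \<longlonglongrightarrow> 1"
    by simp
  have wI: "w n * I n = exp (w n) - 1" for n
  proof -
    have "((\<lambda>x::real. w n * exp (of_real x * w n)) has_integral
        exp (of_real 1 * w n) - exp (of_real 0 * w n)) {0..1}"
    proof (rule fundamental_theorem_of_calculus)
      fix x :: real
      have "((\<lambda>z. exp (z * w n)) has_field_derivative w n * exp (of_real x * w n)) (at (of_real x))"
        by (auto intro!: derivative_eq_intros)
      from has_vector_derivative_real_field[OF this]
      show "((\<lambda>x. exp (of_real x * w n)) has_vector_derivative w n * exp (of_real x * w n))
          (at x within {0..1})"
        by (simp add: o_def has_vector_derivative_at_within)
    qed simp
    from integral_unique[OF this] show ?thesis
      by (simp add: I_def)
  qed
  have "\<forall>\<^sub>F n in sequentially. I n \<noteq> 0"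
    using I1 by (rule tendsto_imp_eventually_ne) simp
  then have ev: "\<forall>\<^sub>F n in sequentially. (exp (w n) - 1) / I n = w n"
    by eventually_elim (simp flip: wI)
  have "(\<lambda>n. (exp (w n) - 1) / I n) \<longlonglongrightarrow> (1 - 1) / 1"
    by (intro tendsto_intros w1 I1) simp
  with ev show ?thesis
    by (simp add: tendsto_cong)
qed

section \<open>Divided differences of the exponential\<close>

text \<open>Filling in the removable singularity keeps divided differences of \<open>exp\<close>
  continuous when their two points merge.\<close>

definition exp_quot :: "complex \<Rightarrow> complex" where
  "exp_quot z = (if z = 0 then 1 else (exp z - 1) / z)"

lemma exp_quot_0 [simp]: "exp_quot 0 = 1"
  by (simp add: exp_quot_def)

lemma mult_exp_quot: "z * exp_quot z = exp z - 1"
  by (simp add: exp_quot_def)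

lemma continuous_on_exp_quot: "continuous_on UNIV exp_quot"
proof -
  have "isCont exp_quot z" for z
  proof (cases "z = 0")
    case True
    have "(exp_quot \<longlongrightarrow> 1) (at 0)"
      by (rule Lim_transform_eventually[OF lim_exp_minus_1])
         (auto simp: exp_quot_def eventually_at_filter)
    then show ?thesis
      using True by (simp add: isCont_def)
  next
    case False
    have "isCont (\<lambda>z. (exp z - 1) / z) z"
      using False by (intro continuous_intros)
    moreover have "\<forall>\<^sub>F y in nhds z. (exp y - 1) / y = exp_quot y"
      using t1_space_nhds[OF False] by eventually_elim (simp add: exp_quot_def)
    ultimately show ?thesis
      by (simp add: isCont_cong)
  qed
  then show ?thesis
    by (simp add: continuous_at_imp_continuous_on)
qed

text \<open>Mean value inequality on the left half-plane, which is convex and on which the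
  derivative \<open>exp\<close> has modulus at most 1.\<close>

lemma norm_exp_diff_le:
  fixes a b :: complex
  assumes "Re a \<le> 0" "Re b \<le> 0"
  shows "norm (exp b - exp a) \<le> norm (b - a)"
proof -
  have "norm (exp b - exp a) \<le> 1 * norm (b - a)"
    by (rule field_differentiable_bound[of "{z. Re z \<le> 0}" exp exp])
       (use assms in \<open>auto simp: convex_halfspace_Re_le intro: DERIV_exp has_field_derivative_at_within\<close>)
  then show ?thesis by simp
qed

text \<open>This is the divided difference of \<open>exp\<close> between the points
  \<open>pairing u \<xi>\<close> and \<open>pairing v \<xi>\<close>, in a form that makes sense also
  when they coincide.\<close>

definition exp_slope :: "complex \<times> complex \<Rightarrow> complex \<times> complex \<Rightarrow> real \<times> real \<Rightarrow> complex" where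
  "exp_slope u v \<xi> = exp (pairing u \<xi>) * exp_quot (pairing v \<xi> - pairing u \<xi>)"

lemma Re_pairing_le_0: "u \<in> dom_U \<Longrightarrow> \<xi> \<in> state_D \<Longrightarrow> Re (pairing u \<xi>) \<le> 0"
  by (auto simp: dom_U_def state_D_def pairing_def mult_nonpos_nonneg)

lemma exp_slope_same [simp]: "exp_slope u u \<xi> = exp (pairing u \<xi>)"
  by (simp add: exp_slope_def)

lemma exp_pairing_diff:
  "exp (pairing v \<xi>) - exp (pairing u \<xi>) = (pairing v \<xi> - pairing u \<xi>) * exp_slope u v \<xi>"
proof -
  have "(pairing v \<xi> - pairing u \<xi>) * exp_slope u v \<xi> =
      exp (pairing u \<xi>) * (exp (pairing v \<xi> - pairing u \<xi>) - 1)"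
    by (simp add: exp_slope_def mult_exp_quot[symmetric] mult_ac)
  then show ?thesis
    by (simp add: exp_diff algebra_simps)
qed

text \<open>The bound is uniform in \<open>u\<close> and \<open>v\<close>, so a coordinate of
  \<open>\<xi>\<close> times the slope is dominated by \<open>norm \<xi>\<close>; this is how the
  first moment enters.\<close>

lemma norm_exp_slope_le:
  assumes "u \<in> dom_U" "v \<in> dom_U" "\<xi> \<in> state_D"
  shows "norm (exp_slope u v \<xi>) \<le> 1"
proof (cases "pairing v \<xi> = pairing u \<xi>")
  case True
  then show ?thesis
    using Re_pairing_le_0[OF assms(1,3)] by (simp add: exp_slope_def)
next
  case False
  have "norm (pairing v \<xi> - pairing u \<xi>) * norm (exp_slope u v \<xi>) \<le> norm (pairing v \<xi> - pairing u \<xi>)"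
    using norm_exp_diff_le[OF Re_pairing_le_0[OF assms(1,3)] Re_pairing_le_0[OF assms(2,3)]]
    by (simp add: exp_pairing_diff norm_mult)
  then show ?thesis
    using False by simp
qed

lemma tendsto_exp_slope:
  assumes "(u \<longlongrightarrow> a) F" "(v \<longlongrightarrow> b) F"
  shows "((\<lambda>n. exp_slope (u n) (v n) \<xi>) \<longlongrightarrow> exp_slope a b \<xi>) F"
proof -
  have "((\<lambda>n. exp_quot (pairing (v n) \<xi> - pairing (u n) \<xi>)) \<longlongrightarrow>
      exp_quot (pairing b \<xi> - pairing a \<xi>)) F"
    by (rule continuous_on_tendsto_compose[OF continuous_on_exp_quot])
       (auto simp: pairing_def intro!: tendsto_intros assms)
  then show ?thesis
    unfolding exp_slope_def by (force simp: pairing_def intro: tendsto_intros assms)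
qed

lemma continuous_on_pairing: "continuous_on S (pairing u)"
  unfolding pairing_def by (intro continuous_intros)

lemma continuous_on_exp_slope: "continuous_on S (exp_slope u v)"
  unfolding exp_slope_def
  by (intro continuous_intros continuous_on_pairing
      continuous_on_compose2[OF continuous_on_exp_quot]) auto

section \<open>Difference quotients along sequences\<close>

lemma has_vector_derivative_iff_quotient:
  fixes f :: "real \<Rightarrow> 'a :: real_normed_vector"
  shows "(f has_vector_derivative D) (at x within S) \<longleftrightarrow>
    ((\<lambda>y. (f y - f x) /\<^sub>R (y - x)) \<longlongrightarrow> D) (at x within S)"
proof -
  have "norm (f y - f x - (y - x) *\<^sub>R D) / norm (y - x) = norm ((f y - f x) /\<^sub>R (y - x) - D)"
    if "y \<noteq> x" for y
  proof -
    have "(f y - f x) /\<^sub>R (y - x) - D = (f y - f x - (y - x) *\<^sub>R D) /\<^sub>R (y - x)"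
      using that by (simp add: scaleR_diff_right)
    then show ?thesis
      by (simp add: divide_inverse abs_inverse mult.commute)
  qed
  then have "\<forall>\<^sub>F y in at x within S. norm (f y - f x - (y - x) *\<^sub>R D) / norm (y - x) =
      norm ((f y - f x) /\<^sub>R (y - x) - D)"
    by (auto simp: eventually_at_filter)
  then show ?thesis
    unfolding has_vector_derivative_def has_derivative_iff_norm
    by (simp add: bounded_linear_scaleR_left tendsto_cong tendsto_norm_zero_iff flip: LIM_zero_iff[of _ D])
qed

lemma tendsto_integral_quotient:
  fixes f :: "real \<Rightarrow> complex"
  assumes f: "continuous_on {0..} f" and s: "s \<ge> 0"
    and t: "\<And>n. t n > 0" "t \<longlonglongrightarrow> 0"
  shows "(\<lambda>n. (integral {0..s + t n} f - integral {0..s} f) / of_real (t n)) \<longlonglongrightarrow> f s"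
proof -
  define F where "F a = integral {0..a} f" for a
  \<comment> \<open>A bound for the sequence places all points \<open>s + t n\<close> in one compact
    interval, on which the fundamental theorem of calculus applies, one-sidedly if
    \<open>s = 0\<close>.\<close>
  obtain B where B: "t n \<le> B" for n
    using convergent_imp_bounded[OF t(2)] unfolding bounded_iff by (metis abs_le_D1 rangeI real_norm_def)
  have "(F has_vector_derivative f s) (at s within {0..s + B})"
    unfolding F_def using B[of 0] t(1)[of 0] s
    by (intro integral_has_vector_derivative continuous_on_subset[OF f]) auto
  then have "((\<lambda>y. (F y - F s) /\<^sub>R (y - s)) \<longlongrightarrow> f s) (at s within {0..s + B})"
    by (simp add: has_vector_derivative_iff_quotient)
  moreover have "(\<lambda>n. s + t n) \<longlonglongrightarrow> s"
    using tendsto_add[OF tendsto_const t(2), of s] by simp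
  moreover have "s + t n \<in> {0..s + B} - {s}" for n
    using B[of n] t(1)[of n] s by simp
  ultimately have "(\<lambda>n. (F (s + t n) - F s) /\<^sub>R (s + t n - s)) \<longlonglongrightarrow> f s"
    unfolding tendsto_at_iff_sequentially comp_def by (elim allE[where x = "\<lambda>n. s + t n"]) auto
  then show ?thesis
    by (simp add: F_def scaleR_conv_of_real divide_inverse mult.commute)
qed

section \<open>Kernels and integrals of functions of linear growth\<close>

locale integrable_HA_semigroup =
  fixes Q :: "real \<Rightarrow> real \<times> real \<Rightarrow> (real \<times> real) measure"
    and \<psi> :: "real \<Rightarrow> complex \<times> complex \<Rightarrow> complex \<times> complex"
  assumes semigroup: "transition_semigroup borel_D Q"
    and affine: "affine_exponent Q \<psi>"
    and stoch_cont: "stochastically_continuous Q"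
    and norm_finite: "\<And>t x. t \<ge> 0 \<Longrightarrow> x \<in> state_D \<Longrightarrow> (\<integral>\<^sup>+ \<xi>. ennreal (norm \<xi>) \<partial>Q t x) < \<infinity>"
    and norm_cont: "\<And>x. x \<in> state_D \<Longrightarrow>
           weakly_continuous state_D (\<lambda>t. density (Q t x) (\<lambda>\<xi>. ennreal (norm \<xi>)))"
begin

lemma space_borel_D [simp]: "space borel_D = state_D"
  by (simp add: space_restrict_space)

lemma kernel_measurable: "t \<ge> 0 \<Longrightarrow> Q t \<in> borel_D \<rightarrow>\<^sub>M prob_algebra borel_D"
  using semigroup by (simp add: transition_semigroup_def)

lemma
  assumes "t \<ge> 0" "x \<in> state_D"
  shows sets_kernel: "sets (Q t x) = sets borel_D"
    and prob_space_kernel: "prob_space (Q t x)"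
    and space_kernel: "space (Q t x) = state_D"
proof -
  have "Q t x \<in> space (prob_algebra borel_D)"
    using measurable_space[OF kernel_measurable] assms by simp
  then show s: "sets (Q t x) = sets borel_D" and "prob_space (Q t x)"
    by (auto simp: space_prob_algebra)
  show "space (Q t x) = state_D"
    using sets_eq_imp_space_eq[OF s] by simp
qed

lemma borel_measurable_kernel:
  assumes "t \<ge> 0" "x \<in> state_D" "continuous_on state_D g"
  shows "g \<in> borel_measurable (Q t x)"
  using borel_measurable_continuous_on_restrict[OF assms(3)] sets_kernel[OF assms(1,2)]
  by (simp cong: measurable_cong_sets)

lemma integrable_norm:
  assumes "t \<ge> 0" "x \<in> state_D"
  shows "integrable (Q t x) norm"
  using norm_finite[OF assms] borel_measurable_kernel[OF assms, of norm]
  by (auto intro!: integrableI_bounded continuous_intros)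

lemma integrable_linear_growth:
  fixes g :: "real \<times> real \<Rightarrow> 'b :: {banach, second_countable_topology}"
  assumes "t \<ge> 0" "x \<in> state_D" "continuous_on state_D g"
    and "\<And>\<xi>. \<xi> \<in> state_D \<Longrightarrow> norm (g \<xi>) \<le> 1 + norm \<xi>"
  shows "integrable (Q t x) g"
proof (rule Bochner_Integration.integrable_bound)
  interpret prob_space "Q t x"
    using assms by (intro prob_space_kernel)
  show "integrable (Q t x) (\<lambda>\<xi>. 1 + norm \<xi>)"
    using integrable_norm[OF assms(1,2)] by simp
  show "AE \<xi> in Q t x. norm (g \<xi>) \<le> norm (1 + norm \<xi>)"
    using assms(4) by (auto simp: space_kernel[OF assms(1,2)] intro!: AE_I2 order_trans[OF assms(4)])
qed (use assms in \<open>simp add: borel_measurable_kernel\<close>)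

text \<open>Weak continuity applied to \<open>\<xi>/|\<xi>|\<close>-type functions fails at the origin. Instead,
  \<open>g = g / (1 + |\<xi>|) + |\<xi>| * (g / (1 + |\<xi>|))\<close> splits \<open>g\<close> between the two hypotheses.\<close>

lemma continuous_on_integral_real:
  fixes g :: "real \<times> real \<Rightarrow> real"
  assumes x: "x \<in> state_D" and g: "continuous_on state_D g"
    and le: "\<And>\<xi>. \<xi> \<in> state_D \<Longrightarrow> norm (g \<xi>) \<le> 1 + norm \<xi>"
  shows "continuous_on {0..} (\<lambda>t. \<integral>\<xi>. g \<xi> \<partial>Q t x)"
proof -
  define h where "h \<xi> = g \<xi> / (1 + norm \<xi>)" for \<xi>
  have pos: "1 + norm \<xi> > 0" for \<xi> :: "real \<times> real"
    by (simp add: add_pos_nonneg)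
  have h: "continuous_on state_D h"
    unfolding h_def using pos by (intro continuous_intros g) (metis less_irrefl)
  have h1: "norm (h \<xi>) \<le> 1" if "\<xi> \<in> state_D" for \<xi>
    using le[OF that] pos[of \<xi>] by (simp add: h_def divide_le_eq)
  then have "bounded (h ` state_D)"
    by (intro boundedI) auto
  then have c1: "continuous_on {0..} (\<lambda>t. \<integral>\<xi>. h \<xi> \<partial>Q t x)"
    and c2: "continuous_on {0..} (\<lambda>t. \<integral>\<xi>. h \<xi> \<partial>density (Q t x) (\<lambda>\<xi>. ennreal (norm \<xi>)))"
    using stoch_cont norm_cont[OF x] h x
    by (auto simp: stochastically_continuous_def weakly_continuous_def)
  have "(\<integral>\<xi>. h \<xi> \<partial>Q t x) + (\<integral>\<xi>. h \<xi> \<partial>density (Q t x) (\<lambda>\<xi>. ennreal (norm \<xi>))) =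
      (\<integral>\<xi>. g \<xi> \<partial>Q t x)" if "t \<in> {0..}" for t
  proof -
    have t: "t \<ge> 0" using that by simp
    have "(\<integral>\<xi>. h \<xi> \<partial>density (Q t x) (\<lambda>\<xi>. ennreal (norm \<xi>))) = (\<integral>\<xi>. norm \<xi> * h \<xi> \<partial>Q t x)"
      by (subst integral_density)
         (auto intro!: borel_measurable_kernel[OF t x] h continuous_intros)
    moreover have "integrable (Q t x) h"
      by (rule integrable_linear_growth[OF t x h]) (smt (verit) h1 norm_ge_zero)
    moreover have "integrable (Q t x) (\<lambda>\<xi>. norm \<xi> * h \<xi>)"
    proof (rule integrable_linear_growth[OF t x])
      show "continuous_on state_D (\<lambda>\<xi>. norm \<xi> * h \<xi>)"
        by (intro continuous_intros h)
      show "norm (norm \<xi> * h \<xi>) \<le> 1 + norm \<xi>" if "\<xi> \<in> state_D" for \<xi>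
        using mult_left_mono[OF h1[OF that], of "norm \<xi>"] by (simp add: abs_mult)
    qed
    moreover have "h \<xi> + norm \<xi> * h \<xi> = g \<xi>" for \<xi>
    proof -
      have "h \<xi> * (1 + norm \<xi>) = g \<xi>"
        using pos[of \<xi>] by (simp add: h_def)
      then show ?thesis by (simp add: algebra_simps)
    qed
    ultimately show ?thesis
      by (simp flip: Bochner_Integration.integral_add)
  qed
  then show ?thesis
    by (rule continuous_on_eq[OF continuous_on_add[OF c1 c2]])
qed

text \<open>Weak continuity is tested on real functions, so real and imaginary parts are treated
  separately.\<close>

lemma continuous_on_integral:
  fixes g :: "real \<times> real \<Rightarrow> complex"
  assumes x: "x \<in> state_D" and g: "continuous_on state_D g"
    and le: "\<And>\<xi>. \<xi> \<in> state_D \<Longrightarrow> norm (g \<xi>) \<le> 1 + norm \<xi>"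
  shows "continuous_on {0..} (\<lambda>t. \<integral>\<xi>. g \<xi> \<partial>Q t x)"
proof -
  have "continuous_on {0..} (\<lambda>t. complex_of_real (\<integral>\<xi>. Re (g \<xi>) \<partial>Q t x) +
      \<i> * complex_of_real (\<integral>\<xi>. Im (g \<xi>) \<partial>Q t x))"
    using order_trans[OF abs_Re_le_cmod le] order_trans[OF abs_Im_le_cmod le]
    by (intro continuous_intros continuous_on_integral_real[OF x] g) auto
  moreover have "complex_of_real (\<integral>\<xi>. Re (g \<xi>) \<partial>Q t x) +
      \<i> * complex_of_real (\<integral>\<xi>. Im (g \<xi>) \<partial>Q t x) = (\<integral>\<xi>. g \<xi> \<partial>Q t x)" if "t \<in> {0..}" for t
    using integrable_linear_growth[OF _ x g le] that by (simp add: complex_eq_iff)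
  ultimately show ?thesis
    by (rule continuous_on_eq)
qed

section \<open>The Fourier-Laplace transform and the semigroup property\<close>

text \<open>The function \<open>f\<^sub>x\<close> of the overview.\<close>

definition ftrans :: "real \<times> real \<Rightarrow> real \<Rightarrow> complex \<times> complex \<Rightarrow> complex" where
  "ftrans x t u = (\<integral>\<xi>. exp (pairing u \<xi>) \<partial>Q t x)"

lemma ftrans_eq: "t \<ge> 0 \<Longrightarrow> x \<in> state_D \<Longrightarrow> u \<in> dom_U \<Longrightarrow> ftrans x t u = exp (pairing (\<psi> t u) x)"
  using affine by (simp add: affine_exponent_def ftrans_def)

lemma continuous_on_exp_pairing: "continuous_on S (\<lambda>\<xi>. exp (pairing u \<xi>))"
  by (intro continuous_intros continuous_on_pairing)

lemma norm_exp_pairing_le: "u \<in> dom_U \<Longrightarrow> \<xi> \<in> state_D \<Longrightarrow> norm (exp (pairing u \<xi>)) \<le> 1"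
  using Re_pairing_le_0 by simp

lemma norm_exp_pairing_le': "u \<in> dom_U \<Longrightarrow> \<xi> \<in> state_D \<Longrightarrow> norm (exp (pairing u \<xi>)) \<le> 1 + norm \<xi>"
  using norm_exp_pairing_le by (smt (verit) norm_ge_zero)

lemma integrable_exp_pairing:
  "t \<ge> 0 \<Longrightarrow> x \<in> state_D \<Longrightarrow> u \<in> dom_U \<Longrightarrow> integrable (Q t x) (\<lambda>\<xi>. exp (pairing u \<xi>))"
  by (rule integrable_linear_growth[OF _ _ continuous_on_exp_pairing norm_exp_pairing_le'])

lemma continuous_on_ftrans: "x \<in> state_D \<Longrightarrow> u \<in> dom_U \<Longrightarrow> continuous_on {0..} (\<lambda>t. ftrans x t u)"
  unfolding ftrans_def
  by (rule continuous_on_integral[OF _ continuous_on_exp_pairing norm_exp_pairing_le'])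

lemma norm_ftrans_le:
  assumes "t \<ge> 0" "x \<in> state_D" "u \<in> dom_U"
  shows "norm (ftrans x t u) \<le> 1"
proof -
  interpret prob_space "Q t x"
    using assms by (intro prob_space_kernel)
  have "norm (ftrans x t u) \<le> (\<integral>\<xi>. norm (exp (pairing u \<xi>)) \<partial>Q t x)"
    unfolding ftrans_def by (rule integral_norm_bound)
  also have "\<dots> \<le> (\<integral>\<xi>. 1 \<partial>Q t x)"
    using assms norm_exp_pairing_le
    by (intro integral_mono Bochner_Integration.integrable_norm integrable_exp_pairing)
       (auto simp: space_kernel simp del: norm_exp_eq_Re)
  finally show ?thesis by (simp add: prob_space)
qed

text \<open>The transform has modulus at most 1, so \<open>pairing (\<psi> t u) x\<close> has
  nonpositive real part for every state \<open>x\<close>. The opposite states \<open>(0, 1)\<close>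
  and \<open>(0, -1)\<close> force the second component to be purely imaginary.\<close>

lemma \<psi>_in_dom_U:
  assumes "t \<ge> 0" "u \<in> dom_U"
  shows "\<psi> t u \<in> dom_U"
proof -
  have "Re (pairing (\<psi> t u) x) \<le> 0" if "x \<in> state_D" for x
    using norm_ftrans_le[OF assms(1) that assms(2)] by (simp add: ftrans_eq[OF assms(1) that assms(2)])
  from this[of "(1, 0)"] this[of "(0, 1)"] this[of "(0, -1)"] show ?thesis
    by (auto simp: dom_U_def state_D_def pairing_def mem_Times_iff)
qed

lemma integral_0:
  assumes "x \<in> state_D" "continuous_on state_D g"
  shows "(\<integral>\<xi>. g \<xi> \<partial>Q 0 x) = (g x :: 'b :: {banach, second_countable_topology})"
proof -
  have "Q 0 x = return borel_D x"
    using semigroup assms by (simp add: transition_semigroup_def)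
  then show ?thesis
    using assms by (simp add: integral_return borel_measurable_continuous_on_restrict)
qed

text \<open>Chapman-Kolmogorov: integrating the exponential first against \<open>Q t \<xi>\<close>
  gives the exponential with \<open>\<psi> t u\<close> in place of \<open>u\<close>, by the affine
  property.\<close>

lemma ftrans_add:
  assumes r: "r \<ge> 0" and t: "t \<ge> 0" and x: "x \<in> state_D" and u: "u \<in> dom_U"
  shows "ftrans x (r + t) u = ftrans x r (\<psi> t u)"
proof -
  interpret prob_space "Q r x"
    using r x by (intro prob_space_kernel)
  have Q: "Q (r + t) x = Q r x \<bind> Q t"
    using semigroup r t x by (simp add: transition_semigroup_def)
  have N: "Q t \<in> Q r x \<rightarrow>\<^sub>M subprob_algebra borel_D"
    using measurable_prob_algebraD[OF kernel_measurable[OF t]] sets_kernel[OF r x]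
    by (simp cong: measurable_cong_sets)
  \<comment> \<open>This is for real integrands and is applied below to real and imaginary parts.
    \<open>B\<close> bounds the integrand and \<open>B'\<close> the mass of the kernels
    \<open>Q t \<xi>\<close>.\<close>
  have bind: "(\<integral>\<eta>. g \<eta> \<partial>(Q r x \<bind> Q t)) = (\<integral>\<xi>. (\<integral>\<eta>. g \<eta> \<partial>Q t \<xi>) \<partial>Q r x)"
    if "continuous_on state_D g" "\<And>\<xi>. \<xi> \<in> state_D \<Longrightarrow> \<bar>g \<xi>\<bar> \<le> 1" for g :: "_ \<Rightarrow> real"
  proof (rule integral_bind[OF _ _ N, where B = 1 and B' = 1])
    show "g \<in> borel_measurable borel_D"
      using that(1) by (rule borel_measurable_continuous_on_restrict)
    show "finite_measure (Q r x)"
      by unfold_locales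
    show "AE \<xi> in Q r x. emeasure (Q t \<xi>) (space (Q t \<xi>)) \<le> ennreal 1"
      using prob_space.emeasure_space_1[OF prob_space_kernel[OF t]]
      by (auto simp: space_kernel[OF r x])
  qed (use that in auto)
  let ?e = "\<lambda>\<xi>. exp (pairing u \<xi>)"
  let ?f = "\<lambda>\<xi>. exp (pairing (\<psi> t u) \<xi>)"
  have int: "integrable (Q (r + t) x) ?e" "integrable (Q r x) ?f"
    using assms by (auto intro!: integrable_exp_pairing \<psi>_in_dom_U)
  have e: "(\<integral>\<eta>. ?e \<eta> \<partial>Q t \<xi>) = ?f \<xi>" "integrable (Q t \<xi>) ?e" if "\<xi> \<in> space (Q r x)" for \<xi>
    using ftrans_eq[of t \<xi> u] integrable_exp_pairing[of t \<xi> u] that assms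
    by (auto simp: ftrans_def space_kernel)
  have reim: "(\<integral>\<eta>. Re (?e \<eta>) \<partial>Q t \<xi>) = Re (?f \<xi>)" "(\<integral>\<eta>. Im (?e \<eta>) \<partial>Q t \<xi>) = Im (?f \<xi>)"
    if "\<xi> \<in> space (Q r x)" for \<xi>
    using e[OF that] by (metis integral_Re, metis integral_Im)
  have "(\<integral>\<eta>. Re (?e \<eta>) \<partial>Q (r + t) x) = (\<integral>\<xi>. Re (?f \<xi>) \<partial>Q r x)"
    unfolding Q
    by (subst bind)
       (intro continuous_intros continuous_on_exp_pairing Bochner_Integration.integral_cong refl reim
         order_trans[OF abs_Re_le_cmod norm_exp_pairing_le[OF u]] | assumption)+
  moreover have "(\<integral>\<eta>. Im (?e \<eta>) \<partial>Q (r + t) x) = (\<integral>\<xi>. Im (?f \<xi>) \<partial>Q r x)"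
    unfolding Q
    by (subst bind)
       (intro continuous_intros continuous_on_exp_pairing Bochner_Integration.integral_cong refl reim
         order_trans[OF abs_Im_le_cmod norm_exp_pairing_le[OF u]] | assumption)+
  ultimately show ?thesis
    using int by (simp add: ftrans_def complex_eq_iff)
qed

section \<open>Divided differences of the transform and their time integrals\<close>

text \<open>With \<open>c\<close> a coordinate projection, this is one component of the divided
  difference of the transform; for \<open>u = v\<close> it is the formal partial derivative in that
  coordinate.\<close>

definition slope :: "(real \<times> real \<Rightarrow> real) \<Rightarrow> real \<times> real \<Rightarrow> real \<Rightarrow>
    complex \<times> complex \<Rightarrow> complex \<times> complex \<Rightarrow> complex" where
  "slope c x r u v = (\<integral>\<xi>. of_real (c \<xi>) * exp_slope u v \<xi> \<partial>Q r x)"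

context
  fixes c :: "real \<times> real \<Rightarrow> real"
  assumes c: "c \<in> {fst, snd}"
begin

lemma continuous_on_slope_integrand: "continuous_on S (\<lambda>\<xi>. of_real (c \<xi>) * exp_slope u v \<xi>)"
  using c by (auto intro!: continuous_intros continuous_on_exp_slope)

lemma norm_slope_integrand_le:
  assumes "u \<in> dom_U" "v \<in> dom_U" "\<xi> \<in> state_D"
  shows "norm (of_real (c \<xi>) * exp_slope u v \<xi>) \<le> norm \<xi>"
proof -
  have "\<bar>c \<xi>\<bar> \<le> norm \<xi>"
    using c norm_fst_le[of "fst \<xi>" "snd \<xi>"] norm_snd_le[of "snd \<xi>" "fst \<xi>"] by auto
  then have "\<bar>c \<xi>\<bar> * norm (exp_slope u v \<xi>) \<le> norm \<xi> * 1"
    using norm_exp_slope_le[OF assms] by (intro mult_mono) auto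
  then show ?thesis
    by (simp add: norm_mult)
qed

lemma norm_slope_integrand_le':
  assumes "u \<in> dom_U" "v \<in> dom_U" "\<xi> \<in> state_D"
  shows "norm (of_real (c \<xi>) * exp_slope u v \<xi>) \<le> 1 + norm \<xi>"
  using norm_slope_integrand_le[OF assms] by linarith

lemma integrable_slope_integrand:
  assumes "r \<ge> 0" "x \<in> state_D" "u \<in> dom_U" "v \<in> dom_U"
  shows "integrable (Q r x) (\<lambda>\<xi>. of_real (c \<xi>) * exp_slope u v \<xi>)"
  using assms
  by (intro integrable_linear_growth continuous_on_slope_integrand norm_slope_integrand_le')

lemma continuous_on_slope:
  assumes "x \<in> state_D" "u \<in> dom_U" "v \<in> dom_U"
  shows "continuous_on {0..} (\<lambda>r. slope c x r u v)"
  unfolding slope_def using assms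
  by (intro continuous_on_integral continuous_on_slope_integrand norm_slope_integrand_le')

lemma norm_slope_le:
  assumes "r \<ge> 0" "x \<in> state_D" "u \<in> dom_U" "v \<in> dom_U"
  shows "norm (slope c x r u v) \<le> (\<integral>\<xi>. norm \<xi> \<partial>Q r x)"
proof -
  have "norm (slope c x r u v) \<le> (\<integral>\<xi>. norm (of_real (c \<xi>) * exp_slope u v \<xi>) \<partial>Q r x)"
    unfolding slope_def by (rule integral_norm_bound)
  also have "\<dots> \<le> (\<integral>\<xi>. norm \<xi> \<partial>Q r x)"
    using assms norm_slope_integrand_le
    by (intro integral_mono Bochner_Integration.integrable_norm[OF integrable_slope_integrand]
        integrable_norm) (auto simp: space_kernel)
  finally show ?thesis .
qed

text \<open>Dominated convergence in \<open>\<xi>\<close>, with the majorant \<open>norm\<close>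
  integrable by finiteness of the first moment.\<close>

lemma tendsto_slope:
  assumes rx: "r \<ge> 0" "x \<in> state_D"
    and uv: "\<And>n. u n \<in> dom_U" "\<And>n. v n \<in> dom_U" and lim: "u \<longlonglongrightarrow> a" "v \<longlonglongrightarrow> b"
  shows "(\<lambda>n. slope c x r (u n) (v n)) \<longlonglongrightarrow> slope c x r a b"
  unfolding slope_def
proof (rule integral_dominated_convergence[where w = norm])
  show "AE \<xi> in Q r x. (\<lambda>n. of_real (c \<xi>) * exp_slope (u n) (v n) \<xi>) \<longlonglongrightarrow>
      of_real (c \<xi>) * exp_slope a b \<xi>"
    by (intro AE_I2 tendsto_intros tendsto_exp_slope lim)
  show "AE \<xi> in Q r x. norm (of_real (c \<xi>) * exp_slope (u n) (v n) \<xi>) \<le> norm \<xi>" for n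
    using norm_slope_integrand_le[OF uv] by (auto simp: space_kernel[OF rx])
qed (use rx in \<open>auto intro!: borel_measurable_kernel continuous_on_slope_integrand integrable_norm\<close>)

text \<open>These time integrals are the coefficients of the linear system for the difference
  quotient of \<open>\<psi>\<close>.\<close>

definition cslope where "cslope x s u v = integral {0..s} (\<lambda>r. slope c x r u v)"

lemma integrable_on_slope:
  assumes "x \<in> state_D" "u \<in> dom_U" "v \<in> dom_U"
  shows "(\<lambda>r. slope c x r u v) integrable_on {0..s}"
  by (rule integrable_continuous_real, rule continuous_on_subset[OF continuous_on_slope[OF assms]]) auto

text \<open>Dominated convergence in time. The majorant is the first moment as a function of
  \<open>r\<close>, which is integrable on compact intervals because weak continuity makes it
  continuous.\<close>

lemma tendsto_cslope:
  assumes x: "x \<in> state_D"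
    and uv: "\<And>n. u n \<in> dom_U" "\<And>n. v n \<in> dom_U" and lim: "u \<longlonglongrightarrow> a" "v \<longlonglongrightarrow> b"
  shows "(\<lambda>n. cslope x s (u n) (v n)) \<longlonglongrightarrow> cslope x s a b"
  unfolding cslope_def
proof (rule dominated_convergence(2)[where h = "\<lambda>r. \<integral>\<xi>. norm \<xi> \<partial>Q r x"])
  have "continuous_on {0..} (\<lambda>r. \<integral>\<xi>. norm \<xi> \<partial>Q r x)"
    using x by (intro continuous_on_integral_real) (auto intro!: continuous_intros)
  then show "(\<lambda>r. \<integral>\<xi>. norm \<xi> \<partial>Q r x) integrable_on {0..s}"
    by (intro integrable_continuous_real) (auto elim: continuous_on_subset)
qed (use x uv lim in \<open>auto intro!: integrable_on_slope norm_slope_le tendsto_slope\<close>)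

text \<open>The fundamental theorem of calculus at time 0, where the kernel is the point mass at
  \<open>x\<close>.\<close>

lemma cslope_quotient_tendsto:
  assumes "x \<in> state_D" "u \<in> dom_U" and t: "\<And>n. t n > 0" "t \<longlonglongrightarrow> 0"
  shows "(\<lambda>n. cslope x (t n) u u / of_real (t n)) \<longlonglongrightarrow> of_real (c x) * exp (pairing u x)"
  using tendsto_integral_quotient[OF continuous_on_slope[OF assms(1,2,2)] order_refl t] assms(1)
  by (simp add: cslope_def slope_def integral_0 continuous_on_slope_integrand[of _ u u, simplified])

end

section \<open>The linear system for the difference quotient\<close>

text \<open>The difference of exponentials is exactly the slope times the difference of pairings,
  and the latter is linear in the two coordinates of \<open>\<xi>\<close>.\<close>

lemma ftrans_diff:
  assumes "r \<ge> 0" "x \<in> state_D" "u \<in> dom_U" "v \<in> dom_U"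
  shows "ftrans x r v - ftrans x r u =
    (fst v - fst u) * slope fst x r u v + (snd v - snd u) * slope snd x r u v"
proof -
  have "ftrans x r v - ftrans x r u = (\<integral>\<xi>. exp (pairing v \<xi>) - exp (pairing u \<xi>) \<partial>Q r x)"
    unfolding ftrans_def using assms
    by (simp add: integrable_exp_pairing)
  also have "\<dots> = (\<integral>\<xi>. (fst v - fst u) * (of_real (fst \<xi>) * exp_slope u v \<xi>) +
      (snd v - snd u) * (of_real (snd \<xi>) * exp_slope u v \<xi>) \<partial>Q r x)"
    unfolding exp_pairing_diff by (simp add: pairing_def algebra_simps)
  also have "\<dots> = (fst v - fst u) * slope fst x r u v + (snd v - snd u) * slope snd x r u v"
    unfolding slope_def
    by (subst Bochner_Integration.integral_add)
       (use assms in \<open>auto intro!: integrable_mult_right integrable_slope_integrand\<close>)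
  finally show ?thesis .
qed

lemma ftrans_0: "x \<in> state_D \<Longrightarrow> ftrans x 0 u = exp (pairing u x)"
  unfolding ftrans_def by (rule integral_0[OF _ continuous_on_exp_pairing])

text \<open>The increment \<open>ftrans x (r + t) u - ftrans x r u\<close> is integrated over
  \<open>r\<close> from 0 to \<open>s\<close> in two ways: shifting the interval yields the
  left-hand side, the semigroup property and \<open>ftrans_diff\<close> yield the right-hand
  side.\<close>

lemma integral_ftrans_diff:
  assumes s: "s \<ge> 0" and t: "t \<ge> 0" and x: "x \<in> state_D" and u: "u \<in> dom_U"
  defines "I \<equiv> \<lambda>a. integral {0..a} (\<lambda>r. ftrans x r u)" and "v \<equiv> \<psi> t u"
  shows "I (s + t) - I s - I t =
    (fst v - fst u) * cslope fst x s u v + (snd v - snd u) * cslope snd x s u v"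
proof -
  have v: "v \<in> dom_U"
    unfolding v_def using t u by (rule \<psi>_in_dom_U)
  have int: "(\<lambda>r. ftrans x r w) integrable_on {a..b}" if "w \<in> dom_U" "a \<ge> 0" for a b w
    using that by (intro integrable_continuous_real continuous_on_subset[OF continuous_on_ftrans[OF x]]) auto
  have "I (s + t) - I t = integral {t..s + t} (\<lambda>r. ftrans x r u)"
    using Henstock_Kurzweil_Integration.integral_combine[OF t _ int[OF u order_refl], of "s + t"] s
    by (simp add: I_def algebra_simps)
  also have "\<dots> = integral {0..s} (\<lambda>r. ftrans x (r + t) u)"
    using integral_shift_Icc_real[of 0 s "\<lambda>r. ftrans x r u" t] by (simp add: o_def add.commute)
  also have "\<dots> = integral {0..s} (\<lambda>r. ftrans x r v)"
    unfolding v_def using t x u by (intro Henstock_Kurzweil_Integration.integral_cong) (simp add: ftrans_add)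
  also have "\<dots> - I s = integral {0..s} (\<lambda>r. ftrans x r v - ftrans x r u)"
    unfolding I_def using int[OF u, of 0 s] int[OF v, of 0 s]
    by (simp add: Henstock_Kurzweil_Integration.integral_diff)
  also have "\<dots> = integral {0..s} (\<lambda>r. (fst v - fst u) * slope fst x r u v +
      (snd v - snd u) * slope snd x r u v)"
    using x u v by (intro Henstock_Kurzweil_Integration.integral_cong) (simp add: ftrans_diff)
  also have "\<dots> = (fst v - fst u) * cslope fst x s u v + (snd v - snd u) * cslope snd x s u v"
    using integrable_on_slope[OF _ x u v]
    by (simp add: cslope_def Henstock_Kurzweil_Integration.integral_add integrable_on_mult_right)
  finally show ?thesis
    by (simp add: algebra_simps)
qed

text \<open>The quotient splits into difference quotients of \<open>I\<close> at \<open>s\<close>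
  and at 0, each handled by the fundamental theorem of calculus. Only the combination of the two
  components is shown to converge here; they are separated later.\<close>

lemma tendsto_integral_ftrans_quotient:
  assumes s: "s \<ge> 0" and x: "x \<in> state_D" and u: "u \<in> dom_U" and t: "\<And>n. t n > 0" "t \<longlonglongrightarrow> 0"
  defines "v \<equiv> \<lambda>n. \<psi> (t n) u"
  shows "(\<lambda>n. (fst (v n) - fst u) / of_real (t n) * cslope fst x s u (v n) +
      (snd (v n) - snd u) / of_real (t n) * cslope snd x s u (v n)) \<longlonglongrightarrow>
    ftrans x s u - exp (pairing u x)"
proof -
  define I where "I a = integral {0..a} (\<lambda>r. ftrans x r u)" for a
  note q = tendsto_integral_quotient[OF continuous_on_ftrans[OF x u] _ t, folded I_def]
  have "(\<lambda>n. (I (s + t n) - I s) / of_real (t n) - (I (0 + t n) - I 0) / of_real (t n)) \<longlonglongrightarrow>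
      ftrans x s u - ftrans x 0 u"
    by (intro tendsto_diff q[OF s] q[OF order_refl])
  moreover have "(I (s + t n) - I s) / of_real (t n) - (I (0 + t n) - I 0) / of_real (t n) =
      (I (s + t n) - I s - I (t n)) / of_real (t n)" for n
    by (simp add: I_def diff_divide_distrib)
  moreover have "I (s + t n) - I s - I (t n) = (fst (v n) - fst u) * cslope fst x s u (v n) +
      (snd (v n) - snd u) * cslope snd x s u (v n)" for n
    unfolding I_def v_def using t(1)[of n] s x u by (intro integral_ftrans_diff) auto
  ultimately show ?thesis
    by (simp add: ftrans_0[OF x] add_divide_distrib)
qed

text \<open>Continuity of the transform in time makes the exponential of the pairing of
  \<open>\<psi> (t n) u - u\<close> with any state tend to 1. States on the two axes then give
  convergence of each component.\<close>

lemma \<psi>_tendsto: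
  assumes u: "u \<in> dom_U" and t: "\<And>n. t n \<ge> 0" "t \<longlonglongrightarrow> 0"
  shows "(\<lambda>n. \<psi> (t n) u) \<longlonglongrightarrow> u"
proof -
  have *: "(\<lambda>n. exp (pairing (\<psi> (t n) u) x - pairing u x)) \<longlonglongrightarrow> 1" if x: "x \<in> state_D" for x
  proof -
    have "(\<lambda>n. ftrans x (t n) u) \<longlonglongrightarrow> ftrans x 0 u"
      using continuous_on_tendsto_compose[OF continuous_on_ftrans[OF x u] t(2)] t(1) by simp
    then have "(\<lambda>n. exp (pairing (\<psi> (t n) u) x)) \<longlonglongrightarrow> exp (pairing u x)"
      by (simp only: ftrans_eq[OF t(1) x u] ftrans_0[OF x])
    then have "(\<lambda>n. exp (pairing (\<psi> (t n) u) x) / exp (pairing u x)) \<longlonglongrightarrow> exp (pairing u x) / exp (pairing u x)"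
      by (intro tendsto_divide tendsto_const) simp_all
    then show ?thesis
      by (simp add: exp_diff)
  qed
  have "(\<lambda>n. fst (\<psi> (t n) u) - fst u) \<longlonglongrightarrow> 0"
    by (rule exp_mult_tendsto_1_imp_tendsto_0)
       (use *[of "(_, 0)"] in \<open>simp add: pairing_def state_D_def algebra_simps\<close>)
  moreover have "(\<lambda>n. snd (\<psi> (t n) u) - snd u) \<longlonglongrightarrow> 0"
    by (rule exp_mult_tendsto_1_imp_tendsto_0)
       (use *[of "(0, _)"] in \<open>simp add: pairing_def state_D_def algebra_simps\<close>)
  ultimately show ?thesis
    using tendsto_Pair[of "\<lambda>n. fst (\<psi> (t n) u)" "fst u" sequentially "\<lambda>n. snd (\<psi> (t n) u)" "snd u"]
    by (simp add: LIM_zero_iff)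
qed

lemma \<psi>_0: "u \<in> dom_U \<Longrightarrow> \<psi> 0 u = u"
  using \<psi>_tendsto[of u "\<lambda>_. 0"] by (simp add: LIMSEQ_const_iff)

section \<open>Solving the system and continuity of the derivative\<close>

text \<open>Determinant of the formal Jacobian in \<open>u\<close> of the transforms at the two unit
  vectors, with its entries integrated over time.\<close>

definition jac_det :: "real \<Rightarrow> complex \<times> complex \<Rightarrow> complex" where
  "jac_det s u = cslope fst (1, 0) s u u * cslope snd (0, 1) s u u -
     cslope snd (1, 0) s u u * cslope fst (0, 1) s u u"

text \<open>Cramer's rule for the linear system obtained from \<open>integral_ftrans_diff\<close> after division by
  \<open>t\<close> and passage to the limit \<open>t \<rightarrow> 0\<close>.\<close>

definition \<psi>_deriv :: "real \<Rightarrow> complex \<times> complex \<Rightarrow> complex \<times> complex" where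
  "\<psi>_deriv s u =
     (let d1 = ftrans (1, 0) s u - exp (pairing u (1, 0));
          d2 = ftrans (0, 1) s u - exp (pairing u (0, 1))
      in ((d1 * cslope snd (0, 1) s u u - d2 * cslope snd (1, 0) s u u) / jac_det s u,
          (d2 * cslope fst (1, 0) s u u - d1 * cslope fst (0, 1) s u u) / jac_det s u))"

lemma unit_in_state_D: "(1, 0) \<in> state_D" "(0, 1) \<in> state_D"
  by (auto simp: state_D_def)

text \<open>Divided by the time, the coefficient matrix tends to a diagonal matrix with nonzero
  exponentials on the diagonal, so its determinant is nonzero at some small positive time.\<close>

lemma jac_det_nonzero:
  assumes "u \<in> dom_U"
  obtains s where "s > 0" "jac_det s u \<noteq> 0"
proof -
  define t where "t n = inverse (real (Suc n))" for n
  have t: "\<And>n. t n > 0" "t \<longlonglongrightarrow> 0"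
    using LIMSEQ_inverse_real_of_nat by (simp_all add: t_def[abs_def])
  define q where "q c x n = cslope c x (t n) u u / of_real (t n)" for c x n
  have q: "q c x \<longlonglongrightarrow> of_real (c x) * exp (pairing u x)"
    if "c \<in> {fst, snd}" "x \<in> state_D" for c x
    unfolding q_def using that assms t by (intro cslope_quotient_tendsto) auto
  note unit_in_state_D [simp]
  have "(\<lambda>n. q fst (1, 0) n * q snd (0, 1) n - q snd (1, 0) n * q fst (0, 1) n) \<longlonglongrightarrow>
      exp (pairing u (1, 0)) * exp (pairing u (0, 1)) - 0 * 0"
    using q[of fst "(1, 0)"] q[of snd "(0, 1)"] q[of snd "(1, 0)"] q[of fst "(0, 1)"]
    by (intro tendsto_diff tendsto_mult) simp_all
  then have "\<forall>\<^sub>F n in sequentially. q fst (1, 0) n * q snd (0, 1) n - q snd (1, 0) n * q fst (0, 1) n \<noteq> 0"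
    by (rule tendsto_imp_eventually_ne) simp
  then obtain n where "q fst (1, 0) n * q snd (0, 1) n - q snd (1, 0) n * q fst (0, 1) n \<noteq> 0"
    by (meson eventually_happens trivial_limit_sequentially)
  then have "jac_det (t n) u \<noteq> 0"
    by (auto simp: jac_det_def q_def)
  then show ?thesis
    using t(1) by (intro that)
qed

lemma \<psi>_has_vector_derivative:
  assumes u: "u \<in> dom_U" and s: "s \<ge> 0" and det: "jac_det s u \<noteq> 0"
  shows "((\<lambda>t. \<psi> t u) has_vector_derivative \<psi>_deriv s u) (at 0 within {0..})"
  unfolding has_vector_derivative_iff_quotient tendsto_at_iff_sequentially comp_def
proof (intro allI impI)
  fix t :: "nat \<Rightarrow> real"
  assume "\<forall>n. t n \<in> {0..} - {0}" and t0: "t \<longlonglongrightarrow> 0"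
  then have t: "t n > 0" for n
    by (metis Diff_iff atLeast_iff insertI1 order_le_less)
  define v where "v n = \<psi> (t n) u" for n
  define A where "A n = (fst (v n) - fst u) / of_real (t n)" for n
  define B where "B n = (snd (v n) - snd u) / of_real (t n)" for n
  define M where "M c x n = cslope c x s u (v n)" for c x n
  define d where "d x = ftrans x s u - exp (pairing u x)" for x
  note e = unit_in_state_D
  have vU: "v n \<in> dom_U" for n
    unfolding v_def using t[of n] u by (intro \<psi>_in_dom_U) auto
  have v: "v \<longlonglongrightarrow> u"
    unfolding v_def using t t0 u by (intro \<psi>_tendsto) (auto intro: less_imp_le)
  have M: "M c x \<longlonglongrightarrow> cslope c x s u u" if "c \<in> {fst, snd}" "x \<in> state_D" for c x
    unfolding M_def using that u vU v by (intro tendsto_cslope) auto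
  have D: "(\<lambda>n. A n * M fst x n + B n * M snd x n) \<longlonglongrightarrow> d x" if "x \<in> state_D" for x
    unfolding A_def B_def M_def v_def d_def
    by (rule tendsto_integral_ftrans_quotient[OF s that u t t0])
  have J: "(\<lambda>n. M fst (1, 0) n * M snd (0, 1) n - M snd (1, 0) n * M fst (0, 1) n) \<longlonglongrightarrow> jac_det s u"
    (is "?J \<longlonglongrightarrow> _")
    unfolding jac_det_def by (intro tendsto_intros M e) auto
  have ev: "\<forall>\<^sub>F n in sequentially. ?J n \<noteq> 0"
    using J det by (rule tendsto_imp_eventually_ne)
  \<comment> \<open>Cramer's rule is applied at each index, before the limit: numerator and
    denominator converge by \<open>D\<close>, \<open>M\<close> and \<open>J\<close>, and where
    \<open>?J n\<close> is nonzero the quotient is exactly \<open>A n\<close>. Hence convergence of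
    \<open>A\<close> is a conclusion; \<open>B\<close> is treated alike.\<close>
  have "(\<lambda>n. ((A n * M fst (1, 0) n + B n * M snd (1, 0) n) * M snd (0, 1) n -
      (A n * M fst (0, 1) n + B n * M snd (0, 1) n) * M snd (1, 0) n) / ?J n) \<longlonglongrightarrow> fst (\<psi>_deriv s u)"
    unfolding \<psi>_deriv_def Let_def fst_conv d_def[symmetric]
    by (intro tendsto_intros D M J det e) auto
  moreover have "\<forall>\<^sub>F n in sequentially. ((A n * M fst (1, 0) n + B n * M snd (1, 0) n) * M snd (0, 1) n -
      (A n * M fst (0, 1) n + B n * M snd (0, 1) n) * M snd (1, 0) n) / ?J n = A n"
    using ev by eventually_elim (simp add: divide_eq_eq algebra_simps)
  ultimately have A: "A \<longlonglongrightarrow> fst (\<psi>_deriv s u)"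
    by (rule Lim_transform_eventually)
  have "(\<lambda>n. ((A n * M fst (0, 1) n + B n * M snd (0, 1) n) * M fst (1, 0) n -
      (A n * M fst (1, 0) n + B n * M snd (1, 0) n) * M fst (0, 1) n) / ?J n) \<longlonglongrightarrow> snd (\<psi>_deriv s u)"
    unfolding \<psi>_deriv_def Let_def snd_conv d_def[symmetric]
    by (intro tendsto_intros D M J det e) auto
  moreover have "\<forall>\<^sub>F n in sequentially. ((A n * M fst (0, 1) n + B n * M snd (0, 1) n) * M fst (1, 0) n -
      (A n * M fst (1, 0) n + B n * M snd (1, 0) n) * M fst (0, 1) n) / ?J n = B n"
    using ev by eventually_elim (simp add: divide_eq_eq algebra_simps)
  ultimately have B: "B \<longlonglongrightarrow> snd (\<psi>_deriv s u)"
    by (rule Lim_transform_eventually)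
  have "(\<psi> (t n) u - \<psi> 0 u) /\<^sub>R (t n - 0) = (A n, B n)" for n
    by (simp add: prod_eq_iff A_def B_def v_def \<psi>_0[OF u] scaleR_conv_of_real divide_inverse mult.commute)
  then show "(\<lambda>n. (\<psi> (t n) u - \<psi> 0 u) /\<^sub>R (t n - 0)) \<longlonglongrightarrow> \<psi>_deriv s u"
    using tendsto_Pair[OF A B] by simp
qed

text \<open>A determinant that is nonzero at \<open>a\<close> stays nonzero along sequences tending
  to \<open>a\<close>, with the same \<open>s\<close>. There \<open>D\<close> agrees with
  \<open>\<psi>_deriv s\<close> by uniqueness of the one-sided derivative, and that formula is
  continuous at \<open>a\<close>.\<close>

lemma continuous_\<psi>_deriv:
  assumes a: "a \<in> dom_U" and s: "s \<ge> 0" and det: "jac_det s a \<noteq> 0"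
    and deriv: "\<And>u. u \<in> dom_U \<Longrightarrow> ((\<lambda>t. \<psi> t u) has_vector_derivative D u) (at 0 within {0..})"
  shows "continuous (at a within dom_U) D"
proof (rule continuous_within_sequentiallyI)
  fix u :: "nat \<Rightarrow> complex \<times> complex"
  assume lim: "u \<longlonglongrightarrow> a" and "\<forall>n. u n \<in> dom_U"
  then have u: "u n \<in> dom_U" for n by simp
  note e = unit_in_state_D
  have D: "D w = \<psi>_deriv s w" if "w \<in> dom_U" "jac_det s w \<noteq> 0" for w
    using vector_derivative_unique_within[OF _ deriv[OF that(1)] \<psi>_has_vector_derivative[OF that(1) s that(2)]]
    by (simp add: trivial_limit_within islimpt_in_closure at_within_Ici_at_right)
  have M: "(\<lambda>n. cslope c x s (u n) (u n)) \<longlonglongrightarrow> cslope c x s a a" if "c \<in> {fst, snd}" "x \<in> state_D" for c x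
    using that u lim by (intro tendsto_cslope) auto
  have J: "(\<lambda>n. jac_det s (u n)) \<longlonglongrightarrow> jac_det s a"
    unfolding jac_det_def by (intro tendsto_intros M e) auto
  \<comment> \<open>Continuity of the transform in \<open>u\<close> comes from continuity of
    \<open>\<psi> s\<close>, which is part of the affine property.\<close>
  have f: "(\<lambda>n. ftrans x s (u n)) \<longlonglongrightarrow> ftrans x s a" if x: "x \<in> state_D" for x
  proof -
    have "continuous_on dom_U (\<psi> s)"
      using affine s by (simp add: affine_exponent_def)
    from continuous_on_tendsto_compose[OF this lim a]
    have "(\<lambda>n. \<psi> s (u n)) \<longlonglongrightarrow> \<psi> s a"
      using u by simp
    then have "(\<lambda>n. exp (pairing (\<psi> s (u n)) x)) \<longlonglongrightarrow> exp (pairing (\<psi> s a) x)"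
      unfolding pairing_def by (intro tendsto_intros)
    then show ?thesis
      by (simp only: ftrans_eq[OF s x] u a)
  qed
  have "(\<lambda>n. \<psi>_deriv s (u n)) \<longlonglongrightarrow> \<psi>_deriv s a"
    unfolding \<psi>_deriv_def Let_def pairing_def by (intro tendsto_intros M J f lim det e) auto
  moreover have "\<forall>\<^sub>F n in sequentially. \<psi>_deriv s (u n) = D (u n)"
    using tendsto_imp_eventually_ne[OF J det] by eventually_elim (simp add: D u)
  ultimately show "(\<lambda>n. D (u n)) \<longlonglongrightarrow> D a"
    using D[OF a det] Lim_transform_eventually by simp
qed

lemma regular: "regular_HA_semigroup Q"
proof -
  \<comment> \<open>The time \<open>s\<close> may depend on \<open>u\<close>, so \<open>D\<close> is
    chosen without reference to it; a common \<open>s\<close> is used only near the origin.\<close>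
  have "\<exists>D. ((\<lambda>t. \<psi> t u) has_vector_derivative D) (at 0 within {0..})" if "u \<in> dom_U" for u
    using \<psi>_has_vector_derivative[OF that] jac_det_nonzero[OF that] by (metis less_imp_le)
  then obtain D where D: "\<And>u. u \<in> dom_U \<Longrightarrow> ((\<lambda>t. \<psi> t u) has_vector_derivative D u) (at 0 within {0..})"
    by metis
  have 0: "0 \<in> dom_U"
    by (simp add: dom_U_def zero_prod_def)
  obtain s where "s > 0" "jac_det s 0 \<noteq> 0"
    using jac_det_nonzero[OF 0] by blast
  then have "continuous (at 0 within dom_U) D"
    by (intro continuous_\<psi>_deriv[OF 0 _ _ D]) auto
  then show ?thesis
    using semigroup affine stoch_cont D unfolding regular_HA_semigroup_def HA_semigroup_def by blast
qed

end

theorem theorem4p1: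
  fixes Q :: "real \<Rightarrow> real \<times> real \<Rightarrow> (real \<times> real) measure"
  assumes "HA_semigroup Q"
    and "stochastically_continuous Q"
    and "\<And>t x. t \<ge> 0 \<Longrightarrow> x \<in> state_D \<Longrightarrow> (\<integral>\<^sup>+ \<xi>. ennreal (norm \<xi>) \<partial>Q t x) < \<infinity>"
    and "\<And>x. x \<in> state_D \<Longrightarrow>
           weakly_continuous state_D (\<lambda>t. density (Q t x) (\<lambda>\<xi>. ennreal (norm \<xi>)))"
  shows "regular_HA_semigroup Q"
proof -
  obtain \<psi> where "affine_exponent Q \<psi>"
    using assms(1) unfolding HA_semigroup_def by blast
  then interpret integrable_HA_semigroup Q \<psi>
    using assms by unfold_locales (auto simp: HA_semigroup_def)
  show ?thesis
    by (rule regular)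
qed

end
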